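(* Let $P=x^n+a_1x^{n-1}+\cdots+a_n$ with $a=(a_1,\ldots,a_n)\in\mathbb{C}^n$, let $\Sigma\subset\mathbb{C}^n$ be the set of those $a$ for which $P$ has a root of multiplicity at least $3$, and for $1\le k\le n$ let $\Sigma_k$ be the projection of $\Sigma$ in the space $\mathbb{C}^{n-1}_k$ of the variables $a^k=(a_1,\ldots,a_{k-1},a_{k+1},\ldots,a_n)$. Set $P_k:=P-\frac{xP'}{n-k}$ for $1\le k\le n-1$ and $P_n:=P'$; set $V_k:=\mathrm{Res}(P_k,P_k',x)$ for $k\ne n-1$ and $V_{n-1}:=\mathrm{Res}(P_{n-1},P_{n-1}',x)/a_n$. Then: (1) For $k=1,\ldots,n$ the set $\Sigma_k$ is defined by the condition $V_k=0$. (2) The sets $\Sigma_k$ are irreducible.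
   Context: The derivative $'$ is with respect to $x$. $\mathbb{C}^{n-1}_k$ denotes the copy of $\mathbb{C}^{n-1}$ with coordinates $a^k$ (all the coefficients except $a_k$), and the projection $\mathbb{C}^n\to\mathbb{C}^{n-1}_k$ is $a\mapsto a^k$ (forgetting the coordinate $a_k$). $\mathrm{Res}(F,G,x)$ is the resultant of $F$ and $G$ regarded as polynomials in $x$ (the determinant of their Sylvester matrix). For $1\le k\le n-1$ the coefficient of $x^{n-k}$ in $P_k$ is $0$, so $P_k\in\mathbb{C}[a^k][x]$, and also $P_n\in\mathbb{C}[a^n][x]$; hence the resultants $\mathrm{Res}(P_k,P_k',x)$ are polynomials in $\mathbb{C}[a^k]$. The polynomial $\mathrm{Res}(P_{n-1},P_{n-1}',x)$ is divisible by $a_n$, so $V_{n-1}$ is a polynomial in $a^{n-1}=(a_1,\ldots,a_{n-2},a_n)$. Irreducibility of the sets is meant in the sense of algebraic sets.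
   Formalization: In (1), {V_k=0} is shown to be the Zariski closure of the projection Σ_k for every k, and Σ_k itself only for k≥n-2; for k≤n-3 literal equality fails (n=4, k=1, (a_2,a_3,a_4)=(1,0,0)). (2) is stated for n≥3, since Σ is empty for n≤2. *)

theory Defs
  imports
    "HOL-Library.Poly_Mapping"
    "HOL-Library.FuncSet"
    "Subresultants.Resultant_Prelim"
begin

text \<open>
  A complex polynomial in indeterminates indexed by \<^typ>\<open>nat\<close> is a finitely supported map from
  monomials (exponent vectors) to complex numbers; this type is an integral domain.
\<close>

type_synonym cmpoly = "(nat \<Rightarrow>\<^sub>0 nat) \<Rightarrow>\<^sub>0 complex"

definition mvar :: "nat \<Rightarrow> cmpoly" where
  "mvar i = Poly_Mapping.single (Poly_Mapping.single i 1) 1"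

definition mconst :: "complex \<Rightarrow> cmpoly" where
  "mconst c = Poly_Mapping.single 0 c"

definition mvars :: "cmpoly \<Rightarrow> nat set" where
  "mvars f = (\<Union>m\<in>Poly_Mapping.keys f. Poly_Mapping.keys m)"

definition meval :: "cmpoly \<Rightarrow> (nat \<Rightarrow> complex) \<Rightarrow> complex" where
  "meval f b = (\<Sum>m\<in>Poly_Mapping.keys f.
     Poly_Mapping.lookup f m * (\<Prod>i\<in>Poly_Mapping.keys m. b i ^ Poly_Mapping.lookup m i))"

text \<open>
  The affine space with coordinates indexed by \<open>I\<close> is the set of all functions on \<open>I\<close>,
  represented by extensional functions, so that a point is determined by its coordinates in \<open>I\<close>.
\<close>

definition affine_space :: "nat set \<Rightarrow> (nat \<Rightarrow> complex) set" where
  "affine_space I = I \<rightarrow>\<^sub>E UNIV"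

definition zero_locus :: "nat set \<Rightarrow> cmpoly set \<Rightarrow> (nat \<Rightarrow> complex) set" where
  "zero_locus I F = {b \<in> affine_space I. \<forall>f\<in>F. meval f b = 0}"

definition algebraic_set :: "nat set \<Rightarrow> (nat \<Rightarrow> complex) set \<Rightarrow> bool" where
  "algebraic_set I S \<longleftrightarrow> (\<exists>F. (\<forall>f\<in>F. mvars f \<subseteq> I) \<and> S = zero_locus I F)"

definition zariski_closure :: "nat set \<Rightarrow> (nat \<Rightarrow> complex) set \<Rightarrow> (nat \<Rightarrow> complex) set" where
  "zariski_closure I S = \<Inter>{T. algebraic_set I T \<and> S \<subseteq> T}"

text \<open>
  Irreducibility in the topology whose closed sets are the algebraic sets. A set is irreducible in
  this sense iff its closure is, and for an algebraic set \<open>S\<close> this says that \<open>S\<close> is nonempty and not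
  the union of two proper algebraic subsets.
\<close>

definition zariski_irreducible :: "nat set \<Rightarrow> (nat \<Rightarrow> complex) set \<Rightarrow> bool" where
  "zariski_irreducible I S \<longleftrightarrow> S \<noteq> {} \<and> S \<subseteq> affine_space I \<and>
     (\<forall>A B. algebraic_set I A \<longrightarrow> algebraic_set I B \<longrightarrow> S \<subseteq> A \<union> B \<longrightarrow> S \<subseteq> A \<or> S \<subseteq> B)"

text \<open>
  Used both at a point of the coefficient space and with the indeterminates as coefficients.
\<close>

definition general_poly :: "nat \<Rightarrow> (nat \<Rightarrow> 'a) \<Rightarrow> 'a :: comm_ring_1 poly" where
  "general_poly n a = monom 1 n + (\<Sum>i = 1..n. monom (a i) (n - i))"

definition triple_root_set :: "nat \<Rightarrow> (nat \<Rightarrow> complex) set" where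
  "triple_root_set n = {a \<in> affine_space {1..n}. \<exists>x. order x (general_poly n a) \<ge> 3}"

definition coords_without :: "nat \<Rightarrow> nat \<Rightarrow> nat set" where
  "coords_without n k = {1..n} - {k}"

definition triple_root_proj :: "nat \<Rightarrow> nat \<Rightarrow> (nat \<Rightarrow> complex) set" where
  "triple_root_proj n k = (\<lambda>a. restrict a (coords_without n k)) ` triple_root_set n"

definition P_gen :: "nat \<Rightarrow> cmpoly poly" where
  "P_gen n = general_poly n mvar"

definition P_red :: "nat \<Rightarrow> nat \<Rightarrow> cmpoly poly" where
  "P_red n k = (if k = n then pderiv (P_gen n)
     else P_gen n - smult (mconst (1 / of_nat (n - k))) (monom 1 1 * pderiv (P_gen n)))"

definition Res_red :: "nat \<Rightarrow> nat \<Rightarrow> cmpoly" where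
  "Res_red n k = resultant (P_red n k) (pderiv (P_red n k))"

text \<open>
  For \<open>k = n - 1\<close> the quotient by the last indeterminate is taken in the polynomial ring; it exists
  and is unique by \<open>V_red_penultimate\<close> below.
\<close>

definition V_red :: "nat \<Rightarrow> nat \<Rightarrow> cmpoly" where
  "V_red n k = (if Suc k = n then (THE V. Res_red n k = V * mvar n) else Res_red n k)"

lemma resultant_const_coeffs:
  fixes p q :: "'a :: comm_ring_1 poly"
  assumes "degree q > 0"
  shows "\<exists>A B. resultant p q = coeff p 0 * A + coeff q 0 * B"
proof -
  define m where "m = degree p"
  define l where "l = degree q"
  define S where "S = sylvester_mat p q"
  have l: "l > 0" using assms by (simp add: l_def)
  have c: "S \<in> carrier_mat (m + l) (m + l)"
    unfolding S_def m_def l_def by (rule sylvester_carrier_mat)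
  have "\<exists>u v. S $$ (i, m + l - 1) * cofactor S i (m + l - 1) = coeff p 0 * u + coeff q 0 * v"
    if i: "i < m + l" for i
  proof -
    let ?c = "cofactor S i (m + l - 1)"
    have e: "S $$ (i, m + l - 1) =
      (if i < l then if i \<le> m + l - 1 \<and> m + l - 1 - i \<le> m then coeff p (m + i - (m + l - 1)) else 0
       else if i - l \<le> m + l - 1 \<and> m + l - 1 \<le> i then coeff q (i - (m + l - 1)) else 0)"
      using sylvester_index_mat[of i p q "m + l - 1"] i l
      unfolding S_def m_def l_def by simp
    consider "S $$ (i, m + l - 1) = coeff p 0" | "S $$ (i, m + l - 1) = coeff q 0"
      | "S $$ (i, m + l - 1) = 0"
    proof (cases "i < l")
      case True
      show ?thesis
      proof (cases "m + l - 1 - i \<le> m")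
        case True
        with \<open>i < l\<close> l have "m + i - (m + l - 1) = 0" by arith
        with e \<open>i < l\<close> True that show ?thesis by (auto split: if_splits)
      qed (use e \<open>i < l\<close> that in auto)
    next
      case False
      have "i - (m + l - 1) = 0" using i by arith
      with e False that show ?thesis by (auto split: if_splits)
    qed
    then show ?thesis
    proof cases
      case 1
      then have "S $$ (i, m + l - 1) * ?c = coeff p 0 * ?c + coeff q 0 * 0" by simp
      then show ?thesis by blast
    next
      case 2
      then have "S $$ (i, m + l - 1) * ?c = coeff p 0 * 0 + coeff q 0 * ?c" by simp
      then show ?thesis by blast
    next
      case 3
      then have "S $$ (i, m + l - 1) * ?c = coeff p 0 * 0 + coeff q 0 * 0" by simp
      then show ?thesis by blast
    qed
  qed
  then obtain u v where uv: "\<And>i. i < m + l \<Longrightarrow>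
    S $$ (i, m + l - 1) * cofactor S i (m + l - 1) = coeff p 0 * u i + coeff q 0 * v i"
    by metis
  have "resultant p q = (\<Sum>i<m + l. S $$ (i, m + l - 1) * cofactor S i (m + l - 1))"
    unfolding resultant_def S_def[symmetric] using l
    by (intro laplace_expansion_column[OF c]) simp
  also have "\<dots> = (\<Sum>i<m + l. coeff p 0 * u i + coeff q 0 * v i)"
    using uv by (intro sum.cong) auto
  also have "\<dots> = coeff p 0 * (\<Sum>i<m + l. u i) + coeff q 0 * (\<Sum>i<m + l. v i)"
    by (simp add: sum.distrib sum_distrib_left)
  finally show ?thesis by blast
qed

lemma coeff_general_poly:
  "coeff (general_poly n a) j = (if j = n then 1 else if j < n then a (n - j) else 0)"
proof -
  have "(\<Sum>i = 1..n. coeff (monom (a i) (n - i)) j) = (\<Sum>i = 1..n. if i = n - j \<and> j < n then a i else 0)"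
    by (rule sum.cong) auto
  also have "\<dots> = (if j < n then a (n - j) else 0)"
    by (cases "j < n") (auto simp: sum.delta)
  finally show ?thesis
    by (simp add: general_poly_def coeff_sum)
qed

lemma coeff_P_red:
  assumes "1 \<le> k" "k < n"
  shows "coeff (P_red n k) j =
    mconst (1 - of_nat j / of_nat (n - k)) * (if j = n then 1 else if j < n then mvar (n - j) else 0)"
proof -
  have a: "coeff (monom 1 1 * pderiv p) j = of_nat j * coeff p j" for p :: "cmpoly poly"
    by (cases j) (auto simp: coeff_monom_mult coeff_pderiv)
  have b: "mconst c * (of_nat j * x) = mconst (of_nat j * c) * x" for c and x :: cmpoly
  proof -
    have "mconst (of_nat j * c) = of_nat j * mconst c"
      by (simp add: mconst_def mult_single flip: single_of_nat)
    then show ?thesis by (simp only: mult.assoc mult.left_commute)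
  qed
  have c: "mconst (1 - c) = 1 - mconst c" for c by (simp add: mconst_def single_diff)
  have d: "of_nat j * (1 / of_nat (n - k)) = (of_nat j / of_nat (n - k) :: complex)" by simp
  have "coeff (P_red n k) j =
    coeff (P_gen n) j - mconst (of_nat j / of_nat (n - k)) * coeff (P_gen n) j"
  proof -
    have "P_red n k =
      P_gen n - smult (mconst (1 / of_nat (n - k))) (monom 1 1 * pderiv (P_gen n))"
      using assms by (simp add: P_red_def)
    then show ?thesis by (simp only: coeff_diff coeff_smult a b d)
  qed
  also have "\<dots> = mconst (1 - of_nat j / of_nat (n - k)) * coeff (P_gen n) j"
    by (simp only: c left_diff_distrib mult_1_left)
  finally show ?thesis by (simp only: P_gen_def coeff_general_poly)
qed

lemma mconst_eq_0_iff [simp]: "mconst c = 0 \<longleftrightarrow> c = 0"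
  unfolding mconst_def by (metis lookup_single_eq lookup_zero single_zero)

lemma mvar_neq_0 [simp]: "mvar i \<noteq> 0"
  unfolding mvar_def by (metis lookup_single_eq lookup_zero zero_neq_one)

lemma degree_pderiv_P_red:
  assumes "1 \<le> k" "k < n"
  shows "degree (pderiv (P_red n k)) > 0"
proof -
  have "1 - of_nat n / (of_nat (n - k) :: complex) \<noteq> 0"
  proof -
    have "(of_nat n :: complex) \<noteq> of_nat (n - k)" "(of_nat (n - k) :: complex) \<noteq> 0"
      using assms by auto
    then show ?thesis by simp
  qed
  then have "coeff (P_red n k) n \<noteq> 0"
    using coeff_P_red[OF assms, of n] by simp
  then have "coeff (pderiv (P_red n k)) (n - 1) \<noteq> 0"
    using assms by (simp add: coeff_pderiv)
  then have "n - 1 \<le> degree (pderiv (P_red n k))" by (rule le_degree)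
  then show ?thesis using assms by simp
qed

lemma V_red_penultimate:
  assumes "n \<ge> 2"
  shows "\<exists>!V. Res_red n (n - 1) = V * mvar n"
    and "Res_red n (n - 1) = V_red n (n - 1) * mvar n"
proof -
  have k: "1 \<le> n - 1" "n - 1 < n" using assms by auto
  have p0: "coeff (P_red n (n - 1)) 0 = mvar n"
    using assms by (subst coeff_P_red[OF k]) (simp add: mconst_def)
  have d: "n - (n - 1) = 1" using assms by simp
  have q0: "coeff (pderiv (P_red n (n - 1))) 0 = 0"
    unfolding coeff_pderiv by (subst coeff_P_red[OF k], subst d) (simp add: mconst_def)
  obtain A B where "Res_red n (n - 1) = mvar n * A + 0 * B"
    using resultant_const_coeffs[OF degree_pderiv_P_red[OF k], of "P_red n (n - 1)"]
    unfolding Res_red_def p0 q0 by blast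
  then have "Res_red n (n - 1) = A * mvar n" by (simp add: mult.commute)
  then show *: "\<exists>!V. Res_red n (n - 1) = V * mvar n"
    by (intro ex1I[of _ A]) auto
  show "Res_red n (n - 1) = V_red n (n - 1) * mvar n"
    using theI'[OF *] assms by (simp add: V_red_def)
qed

lemma meval_superset:
  assumes "finite S" "Poly_Mapping.keys f \<subseteq> S"
  shows "meval f b = (\<Sum>m\<in>S. Poly_Mapping.lookup f m *
    (\<Prod>i\<in>Poly_Mapping.keys m. b i ^ Poly_Mapping.lookup m i))"
  unfolding meval_def using assms by (intro sum.mono_neutral_left) (auto simp: in_keys_iff)

lemma meval_add: "meval (f + g) b = meval f b + meval g b"
proof -
  let ?S = "Poly_Mapping.keys f \<union> Poly_Mapping.keys g"
  have "Poly_Mapping.keys (f + g) \<subseteq> ?S" by (rule Poly_Mapping.keys_add)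
  then show ?thesis
    by (simp add: meval_superset[of ?S] lookup_add distrib_right sum.distrib)
qed

lemma meval_sum: "meval (\<Sum>i\<in>I. f i) b = (\<Sum>i\<in>I. meval (f i) b)"
  by (induction I rule: infinite_finite_induct) (auto simp: meval_add, simp_all add: meval_def)

lemma meval_single:
  "meval (Poly_Mapping.single m c) b = c * (\<Prod>i\<in>Poly_Mapping.keys m. b i ^ Poly_Mapping.lookup m i)"
  by (cases "c = 0") (auto simp: meval_def)

lemma prod_keys_add:
  fixes b :: "nat \<Rightarrow> complex"
  shows "(\<Prod>i\<in>Poly_Mapping.keys (m + l). b i ^ Poly_Mapping.lookup (m + l) i) =
    (\<Prod>i\<in>Poly_Mapping.keys m. b i ^ Poly_Mapping.lookup m i) *
    (\<Prod>i\<in>Poly_Mapping.keys l. b i ^ Poly_Mapping.lookup l i)"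
proof -
  let ?S = "Poly_Mapping.keys m \<union> Poly_Mapping.keys l"
  have e: "(\<Prod>i\<in>Poly_Mapping.keys h. b i ^ Poly_Mapping.lookup h i) =
      (\<Prod>i\<in>?S. b i ^ Poly_Mapping.lookup h i)"
    if "Poly_Mapping.keys h \<subseteq> ?S" for h
    using that by (intro prod.mono_neutral_left) (auto simp: in_keys_iff)
  show ?thesis
    using e[of "m + l"] e[of m] e[of l] Poly_Mapping.keys_add[of m l]
    by (simp add: lookup_add power_add prod.distrib)
qed

lemma poly_mapping_sum_single:
  "f = (\<Sum>m\<in>Poly_Mapping.keys f. Poly_Mapping.single m (Poly_Mapping.lookup f m))"
  by (rule poly_mapping_eqI) (auto simp: lookup_sum lookup_single when_def in_keys_iff sum.delta)

lemma meval_mult: "meval (f * g) b = meval f b * meval g b"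
proof -
  have "meval (f * g) b =
    meval ((\<Sum>m\<in>Poly_Mapping.keys f. Poly_Mapping.single m (Poly_Mapping.lookup f m)) *
           (\<Sum>l\<in>Poly_Mapping.keys g. Poly_Mapping.single l (Poly_Mapping.lookup g l))) b"
    by (simp flip: poly_mapping_sum_single)
  also have "\<dots> = meval f b * meval g b"
    by (simp add: sum_product mult_single meval_sum meval_single prod_keys_add)
       (simp add: meval_def sum_product mult_ac)
  finally show ?thesis .
qed

lemma meval_mvar: "meval (mvar i) b = b i"
  by (simp add: mvar_def meval_single)

text \<open>
  If \<open>x = 0\<close> is a double root of the polynomial attached to \<open>k \<le> n - 3\<close>, no choice of the
  missing coefficient need turn it into a triple root of the original polynomial. So the
  zero locus of \<^term>\<open>V_red n k\<close> can be strictly larger than the set-theoretic projection; the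
  smallest instance is the point with coordinates \<open>1, 0, 0\<close> for \<open>n = 4\<close>, \<open>k = 1\<close>.
\<close>

lemma triple_root_proj_neq_zero_locus:
  "triple_root_proj 4 1 \<noteq> zero_locus (coords_without 4 1) {V_red 4 1}"
proof -
  define b :: "nat \<Rightarrow> complex" where
    "b = (\<lambda>i. if i = 2 then 1 else if i = 3 \<or> i = 4 then 0 else undefined)"
  have I: "coords_without 4 1 = {2, 3, 4}" by (auto simp: coords_without_def)
  have "b \<in> affine_space (coords_without 4 1)"
    unfolding I by (auto simp: affine_space_def b_def split: if_splits)
  moreover have "meval (V_red 4 1) b = 0"
  proof -
    have k: "1 \<le> (1::nat)" "1 < (4::nat)" by auto
    obtain A B where "Res_red 4 1 = coeff (P_red 4 1) 0 * A + coeff (pderiv (P_red 4 1)) 0 * B"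
      using resultant_const_coeffs[OF degree_pderiv_P_red[OF k], of "P_red 4 1"]
      unfolding Res_red_def by blast
    moreover have "b 3 = 0" "b 4 = 0" by (auto simp: b_def)
    ultimately show ?thesis
      using coeff_P_red[OF k, of 0] coeff_P_red[OF k, of 1]
      by (simp add: V_red_def coeff_pderiv meval_add meval_mult meval_mvar)
  qed
  ultimately have "b \<in> zero_locus (coords_without 4 1) {V_red 4 1}"
    by (simp add: zero_locus_def)
  moreover have "b \<notin> triple_root_proj 4 1"
  proof
    assume "b \<in> triple_root_proj 4 1"
    then obtain a x where a: "b = restrict a {2, 3, 4}" and x: "order x (general_poly 4 a) \<ge> 3"
      unfolding triple_root_proj_def triple_root_set_def I by blast
    have a': "a 2 = 1" "a 3 = 0" "a 4 = 0"
      using fun_cong[OF a, of 2] fun_cong[OF a, of 3] fun_cong[OF a, of 4] by (auto simp: b_def)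
    have g: "general_poly 4 a = [:0, 0, 1, a 1, 1:]"
    proof (rule poly_eqI)
      fix j :: nat
      consider "j = 0" | "j = 1" | "j = 2" | "j = 3" | "j = 4" | "j > 4" by linarith
      then show "coeff (general_poly 4 a) j = coeff [:0, 0, 1, a 1, 1:] j"
        using a' by cases (auto simp: coeff_general_poly numeral_eq_Suc coeff_pCons split: nat.split)
    qed
    have "[:- x, 1:] ^ 3 dvd general_poly 4 a"
      using x by (meson order_1 dvd_trans le_imp_power_dvd)
    then obtain r where r: "[:0, 0, 1, a 1, 1:] = [:- x, 1:] ^ 3 * r"
      unfolding g by (elim dvdE)
    then have d: "[:0, 0, 1, a 1, 1:] = [:- x, 1:] * ([:- x, 1:] * ([:- x, 1:] * r))"
      by (simp only: power3_eq_cube mult.assoc)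
    have 0: "poly [:0, 0, 1, a 1, 1:] x = 0" unfolding d by simp
    have 1: "poly (pderiv [:0, 0, 1, a 1, 1:]) x = 0"
      unfolding d by (simp only: pderiv_mult poly_add poly_mult) simp
    have 2: "poly (pderiv (pderiv [:0, 0, 1, a 1, 1:])) x = 0"
      unfolding d by (simp only: pderiv_mult pderiv_add poly_add poly_mult) simp
    have e0: "x * x * (1 + x * (a 1 + x)) = 0" using 0 by (simp add: algebra_simps)
    have e2: "2 + 6 * (a 1 * x) + 12 * (x * x) = 0"
      using 2 by (simp add: pderiv_pCons algebra_simps)
    have e1: "2 * x + 3 * (a 1 * (x * x)) + 4 * (x * (x * x)) = 0"
      using 1 by (simp add: pderiv_pCons algebra_simps)
    have "x \<noteq> 0" using e2 by auto
    with e0 have "1 + x * (a 1 + x) = 0" by simp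
    then have f0: "1 + a 1 * x + x * x = 0" by (simp add: algebra_simps)
    have "x * (2 + 3 * (a 1 * x) + 4 * (x * x)) = 0" using e1 by (simp add: algebra_simps)
    with \<open>x \<noteq> 0\<close> have f1: "2 + 3 * (a 1 * x) + 4 * (x * x) = 0" by simp
    have "x * x - 1 = (2 + 3 * (a 1 * x) + 4 * (x * x)) - 3 * (1 + a 1 * x + x * x)"
      by (simp add: algebra_simps)
    then have xx: "x * x = 1" unfolding f0 f1 by simp
    moreover have "a 1 * x = - 2" using f0 unfolding xx by (simp add: eq_neg_iff_add_eq_0 add.commute)
    ultimately show False using e2 by simp
  qed
  ultimately show ?thesis by blast
qed

end

theory Submission
  imports Defs
    "HOL-Computational_Algebra.Field_as_Ring"
    "HOL-Computational_Algebra.Fundamental_Theorem_Algebra"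
    "Subresultants.Subresultant_Gcd"
begin

text \<open>
  Passing from \<open>P\<close> to \<open>P_k\<close> removes the coefficient \<open>a_k\<close> and turns a triple root into a root that
  is at least double. Conversely, if \<open>x \<noteq> 0\<close> is a double root of \<open>P_k\<close>, choose \<open>a_k\<close> such that
  \<open>P(x) = 0\<close>; then \<open>P_k(x) = P_k'(x) = 0\<close> forces \<open>P'(x) = P''(x) = 0\<close>. Only a double root of \<open>P_k\<close>
  at \<open>0\<close> with \<open>k \<le> n - 3\<close> can fail to come from a triple root of \<open>P\<close>, but the
  polynomial curve obtained by moving this double root to \<open>t \<noteq> 0\<close> lies in the projection, so the
  point belongs to the closure.
  Irreducibility holds since \<open>(X - x)^3 Q\<close> and \<open>(X - y)^3 R\<close> are joined by the polynomial curve
  \<open>(X - x - t (y - x))^3 (Q + t (R - Q))\<close>, which stays in the set of polynomials with a triple root.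
\<close>

section \<open>Resultants and root orders in one variable\<close>

text \<open>The resultant vanishes iff the gcd is nonconstant, and over the complex numbers a
  nonconstant gcd has a root. The case \<open>p = q = 0\<close> is excluded because its Sylvester
  matrix is empty and has determinant 1.\<close>

lemma resultant_eq_0_iff_common_root:
  fixes p q :: "complex poly"
  assumes "p \<noteq> 0"
  shows "resultant p q = 0 \<longleftrightarrow> (\<exists>x. poly p x = 0 \<and> poly q x = 0)"
proof
  assume "resultant p q = 0"
  then have "degree (gcd p q) \<noteq> 0" by (simp only: resultant_0_gcd not_False_eq_True)
  then have "\<not> constant (poly (gcd p q))" by (simp add: constant_degree)
  then obtain x where x: "poly (gcd p q) x = 0"
    using fundamental_theorem_of_algebra by blast
  then have "poly p x = 0" "poly q x = 0"
    unfolding poly_eq_0_iff_dvd by (auto intro: dvd_trans)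
  then show "\<exists>x. poly p x = 0 \<and> poly q x = 0" by blast
next
  assume "\<exists>x. poly p x = 0 \<and> poly q x = 0"
  then obtain x where "[:- x, 1:] dvd gcd p q" by (auto simp: poly_eq_0_iff_dvd)
  moreover have "gcd p q \<noteq> 0" using assms by simp
  ultimately have "degree [:- x, 1:] \<le> degree (gcd p q)" by (rule dvd_imp_degree_le)
  then show "resultant p q = 0" by (simp add: resultant_0_gcd)
qed

text \<open>This is the multiplicativity of the resultant for the factor \<open>x\<close>, obtained
  by Laplace expansion along the last column. Since \<open>pCons 0 r\<close> has no constant term,
  the only entry there that can be nonzero is \<open>coeff p 0\<close>, in the last shifted copy of
  \<open>p\<close>.\<close>

lemma resultant_pCons_0:
  fixes p r :: "'a :: comm_ring_1 poly"
  assumes "r \<noteq> 0"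
  shows "resultant p (pCons 0 r) = (- 1) ^ degree p * coeff p 0 * resultant p r"
proof -
  define m l S where "m = degree p" and "l = degree r" and "S = sylvester_mat p (pCons 0 r)"
  have d: "degree (pCons 0 r) = Suc l" using assms by (simp add: l_def)
  have c: "S \<in> carrier_mat (m + Suc l) (m + Suc l)"
    unfolding S_def m_def d[symmetric] by (rule sylvester_carrier_mat)
  have idx: "S $$ (i, j) = (if i < Suc l then if i \<le> j \<and> j - i \<le> m then coeff p (m + i - j) else 0
      else if i - Suc l \<le> j \<and> j \<le> i then coeff (pCons 0 r) (i - j) else 0)"
    if "i < m + Suc l" "j < m + Suc l" for i j
    using sylvester_index_mat[of i p "pCons 0 r" j] that unfolding S_def m_def d by simp
  \<comment> \<open>Row \<open>l\<close> is the last of the \<open>Suc l\<close> rows of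
    \<open>p\<close>; without it and the last column, the remaining rows of \<open>pCons 0 r\<close>
    are the shifts of \<open>r\<close>.\<close>
  have "mat_delete S l (m + l) = sylvester_mat p r"
  proof (rule eq_matI)
    fix i j assume "i < dim_row (sylvester_mat p r)" "j < dim_col (sylvester_mat p r)"
    then have ij: "i < m + l" "j < m + l" by (auto simp: m_def l_def)
    have "mat_delete S l (m + l) $$ (i, j) = S $$ (if i < l then i else Suc i, j)"
      using c ij unfolding mat_delete_def by auto
    also have "\<dots> = sylvester_mat p r $$ (i, j)"
      using sylvester_index_mat[of i p r j] ij
      by (subst idx) (auto simp: m_def[symmetric] l_def[symmetric] coeff_pCons Suc_diff_le
        split: nat.splits)
    finally show "mat_delete S l (m + l) $$ (i, j) = sylvester_mat p r $$ (i, j)" .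
  qed (use c in \<open>auto simp: m_def l_def\<close>)
  then have cof: "cofactor S l (m + l) = (- 1) ^ m * resultant p r"
    by (simp add: cofactor_def resultant_def power_add mult.left_commute[of _ "(- 1) ^ m"])
  have "resultant p (pCons 0 r) = (\<Sum>i<m + Suc l. S $$ (i, m + l) * cofactor S i (m + l))"
    unfolding resultant_def S_def[symmetric] by (rule laplace_expansion_column[OF c]) simp
  also have "\<dots> = (\<Sum>i<m + Suc l. if i = l then coeff p 0 * cofactor S i (m + l) else 0)"
    by (intro sum.cong) (auto simp: idx)
  also have "\<dots> = coeff p 0 * cofactor S l (m + l)" by simp
  also have "\<dots> = (- 1) ^ m * coeff p 0 * resultant p r"
    unfolding cof by (simp only: mult_ac)
  finally show ?thesis by (simp add: m_def)
qed

text \<open>In characteristic 0 each derivative lowers the order of a root by one. The hypothesis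
  excludes constants, in particular the zero polynomial.\<close>

lemma order_ge_3_iff:
  fixes p :: "'a :: field_char_0 poly"
  assumes "pderiv p \<noteq> 0"
  shows "order x p \<ge> 3 \<longleftrightarrow>
    poly p x = 0 \<and> poly (pderiv p) x = 0 \<and> poly (pderiv (pderiv p)) x = 0"
proof (cases "poly p x = 0 \<and> poly (pderiv p) x = 0")
  case True
  have "p \<noteq> 0" using assms by auto
  with True assms have ord: "order x p = Suc (Suc (order x (pderiv (pderiv p))))"
    using order_pderiv by metis
  have "pderiv (pderiv p) \<noteq> 0"
  proof
    assume "pderiv (pderiv p) = 0"
    then obtain c where "pderiv p = [:c:]" using pderiv_iszero by blast
    with True assms show False by simp
  qed
  with True ord show ?thesis by (simp add: order_root numeral_3_eq_3 Suc_le_eq)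
next
  case False
  have "p \<noteq> 0" using assms by auto
  with False have "order x p \<le> 1"
    using assms order_pderiv[of p x] order_root[of p x] order_root[of "pderiv p" x] by linarith
  with False show ?thesis by auto
qed

section \<open>Indeterminates and evaluation of multivariate polynomials\<close>

lemma mvars_const [simp]: "mvars (mconst c) = {}"
  by (simp add: mvars_def mconst_def)

lemma mvars_mvar [simp]: "mvars (mvar i) = {i}"
  by (simp add: mvars_def mvar_def)

lemma mvars_0 [simp]: "mvars 0 = {}" and mvars_1 [simp]: "mvars 1 = {}"
  by (simp_all add: mvars_def)

lemma mvars_uminus [simp]: "mvars (- f) = mvars f"
  by (simp add: mvars_def)

lemma mvars_add: "mvars (f + g) \<subseteq> mvars f \<union> mvars g"
  using Poly_Mapping.keys_add[of f g] by (auto simp: mvars_def)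

lemma mvars_mult: "mvars (f * g) \<subseteq> mvars f \<union> mvars g"
proof
  fix i assume "i \<in> mvars (f * g)"
  then obtain m where "m \<in> Poly_Mapping.keys (f * g)" "i \<in> Poly_Mapping.keys m"
    by (auto simp: mvars_def)
  moreover from this obtain a b where
    "m = a + b" "a \<in> Poly_Mapping.keys f" "b \<in> Poly_Mapping.keys g"
    using keys_mult[of f g] by blast
  ultimately show "i \<in> mvars f \<union> mvars g"
    using Poly_Mapping.keys_add[of a b] by (auto simp: mvars_def)
qed

lemma mvars_sum: "(\<And>i. i \<in> A \<Longrightarrow> mvars (f i) \<subseteq> I) \<Longrightarrow> mvars (\<Sum>i\<in>A. f i) \<subseteq> I"
proof (induction A rule: infinite_finite_induct)
  case (insert x A)
  then have "mvars (f x) \<union> mvars (sum f A) \<subseteq> I" by simp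
  then have "mvars (f x + sum f A) \<subseteq> I" by (rule order_trans[OF mvars_add])
  with insert.hyps show ?case by simp
qed simp_all

lemma mvars_prod: "(\<And>i. i \<in> A \<Longrightarrow> mvars (f i) \<subseteq> I) \<Longrightarrow> mvars (\<Prod>i\<in>A. f i) \<subseteq> I"
proof (induction A rule: infinite_finite_induct)
  case (insert x A)
  then have "mvars (f x) \<union> mvars (prod f A) \<subseteq> I" by simp
  then have "mvars (f x * prod f A) \<subseteq> I" by (rule order_trans[OF mvars_mult])
  with insert.hyps show ?case by simp
qed simp_all

lemma mvars_of_nat [simp]: "mvars (of_nat c) = {}"
  using mvars_const[of "of_nat c"] by (simp add: mconst_def)

lemma mvars_det:
  assumes "\<And>i j. i < dim_row A \<Longrightarrow> j < dim_row A \<Longrightarrow> mvars (A $$ (i, j)) \<subseteq> I"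
  shows "mvars (det A) \<subseteq> I"
proof -
  have s: "mvars (signof p) = {}" for p by (simp add: sign_def)
  have "mvars (signof p * (\<Prod>i = 0..<dim_row A. A $$ (i, p i))) \<subseteq> I"
    if "p permutes {0..<dim_row A}" for p
  proof -
    have "mvars (\<Prod>i = 0..<dim_row A. A $$ (i, p i)) \<subseteq> I"
      using permutes_in_image[OF that] by (intro mvars_prod assms) auto
    then show ?thesis using mvars_mult[of "signof p"] s by blast
  qed
  then show ?thesis unfolding det_def by (auto intro!: mvars_sum simp only: mvars_0 split: if_splits)
qed

lemma mvars_resultant:
  assumes "\<And>i. mvars (coeff p i) \<subseteq> I" "\<And>i. mvars (coeff q i) \<subseteq> I"
  shows "mvars (resultant p q) \<subseteq> I"
  unfolding resultant_def
  by (intro mvars_det) (simp add: sylvester_index_mat assms)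

lemma meval_0 [simp]: "meval 0 b = 0" and meval_1 [simp]: "meval 1 b = 1"
  by (simp_all add: meval_def)

lemma meval_mconst [simp]: "meval (mconst c) b = c"
  by (simp add: mconst_def meval_single)

lemma meval_hom: "comm_ring_hom (\<lambda>f. meval f b)"
  by unfold_locales (simp_all add: meval_add meval_mult)

text \<open>The degrees fix the format of the Sylvester matrix, so evaluation may be moved inside
  once neither degree drops.\<close>

lemma meval_resultant:
  assumes "degree (map_poly (\<lambda>f. meval f b) p) = degree p"
    and "degree (map_poly (\<lambda>f. meval f b) q) = degree q"
  shows "meval (resultant p q) b =
    resultant (map_poly (\<lambda>f. meval f b) p) (map_poly (\<lambda>f. meval f b) q)"
  using comm_ring_hom.resultant_map_poly[OF meval_hom assms] by simp

section \<open>Polynomial curves, irreducibility and Zariski closure\<close>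

lemma meval_poly_curve:
  "(\<lambda>t. meval f (\<lambda>i. poly (c i) t)) \<in> range poly"
proof -
  have "(\<lambda>t. meval f (\<lambda>i. poly (c i) t)) = poly (\<Sum>m\<in>Poly_Mapping.keys f.
      smult (Poly_Mapping.lookup f m) (\<Prod>i\<in>Poly_Mapping.keys m. c i ^ Poly_Mapping.lookup m i))"
    by (simp add: meval_def poly_sum poly_prod fun_eq_iff)
  then show ?thesis by blast
qed

text \<open>
  On a polynomial curve every polynomial function becomes univariate, so the product of two
  functions that are nonzero somewhere on the curve is nonzero somewhere on it.
\<close>

lemma zariski_irreducible_if_curves:
  assumes "S \<noteq> {}" "S \<subseteq> affine_space I"
    and "\<And>p q. p \<in> S \<Longrightarrow> q \<in> S \<Longrightarrow>
      \<exists>c. (\<forall>t. (\<lambda>i. poly (c i) t) \<in> S) \<and> (\<lambda>i. poly (c i) 0) = p \<and> (\<lambda>i. poly (c i) 1) = q"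
  shows "zariski_irreducible I S"
  unfolding zariski_irreducible_def
proof (intro conjI allI impI)
  fix A B assume A: "algebraic_set I A" and B: "algebraic_set I B" and AB: "S \<subseteq> A \<union> B"
  obtain F where F: "A = zero_locus I F" using A by (auto simp: algebraic_set_def)
  obtain G where G: "B = zero_locus I G" using B by (auto simp: algebraic_set_def)
  show "S \<subseteq> A \<or> S \<subseteq> B"
  proof (rule ccontr)
    assume "\<not> (S \<subseteq> A \<or> S \<subseteq> B)"
    then obtain p q where p: "p \<in> S" "p \<notin> A" and q: "q \<in> S" "q \<notin> B" by blast
    obtain f where f: "f \<in> F" "meval f p \<noteq> 0" using p assms(2) F by (auto simp: zero_locus_def)
    obtain g where g: "g \<in> G" "meval g q \<noteq> 0" using q assms(2) G by (auto simp: zero_locus_def)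
    obtain c where c: "\<And>t. (\<lambda>i. poly (c i) t) \<in> S"
      "(\<lambda>i. poly (c i) 0) = p" "(\<lambda>i. poly (c i) 1) = q"
      using assms(3)[OF p(1) q(1)] by blast
    obtain u where "(\<lambda>t. meval f (\<lambda>i. poly (c i) t)) = poly u" using meval_poly_curve by blast
    then have u: "meval f (\<lambda>i. poly (c i) t) = poly u t" for t by metis
    obtain v where "(\<lambda>t. meval g (\<lambda>i. poly (c i) t)) = poly v" using meval_poly_curve by blast
    then have v: "meval g (\<lambda>i. poly (c i) t) = poly v t" for t by metis
    have "poly (u * v) t = 0" for t
      using c(1)[of t] AB F G f(1) g(1) by (auto simp: zero_locus_def simp flip: u v)
    then have "u = 0 \<or> v = 0" using poly_all_0_iff_0[of "u * v"] by simp
    then show False using f(2) g(2) u[of 0] v[of 1] c by auto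
  qed
qed (use assms in auto)

text \<open>An equation that holds on a polynomial curve for all \<open>t\<close> other than 0 also
  holds at \<open>t = 0\<close>, so the limit points \<open>z\<close> lie in every algebraic set
  that contains \<open>S\<close>.\<close>

lemma zariski_closure_eq:
  assumes "algebraic_set I Z" "S \<subseteq> Z"
    and "\<And>z. z \<in> Z - S \<Longrightarrow>
      \<exists>c. (\<forall>t. t \<noteq> 0 \<longrightarrow> (\<lambda>i. poly (c i) t) \<in> S) \<and> (\<lambda>i. poly (c i) 0) = z"
  shows "zariski_closure I S = Z"
proof
  show "zariski_closure I S \<subseteq> Z" using assms by (auto simp: zariski_closure_def)
next
  have "z \<in> T" if z: "z \<in> Z" and T: "algebraic_set I T" "S \<subseteq> T" for z T
  proof (cases "z \<in> S")
    case False
    then obtain c where c: "\<And>t. t \<noteq> 0 \<Longrightarrow> (\<lambda>i. poly (c i) t) \<in> S" "(\<lambda>i. poly (c i) 0) = z"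
      using assms(3) z by blast
    obtain F where F: "T = zero_locus I F" using T by (auto simp: algebraic_set_def)
    have "meval f z = 0" if f: "f \<in> F" for f
    proof -
      obtain u where "(\<lambda>t. meval f (\<lambda>i. poly (c i) t)) = poly u" using meval_poly_curve by blast
      then have u: "meval f (\<lambda>i. poly (c i) t) = poly u t" for t by metis
      \<comment> \<open>The extra factor \<open>t\<close> makes the product vanish at 0 as well, so
        it is the zero polynomial.\<close>
      have "poly (pCons 0 u) t = 0" for t
        using c(1)[of t] T(2) F f by (cases "t = 0") (auto simp: zero_locus_def simp flip: u)
      then have "u = 0" using poly_all_0_iff_0[of "pCons 0 u"] by simp
      then show ?thesis using u[of 0] c by simp
    qed
    moreover have "z \<in> affine_space I"
      using z assms(1) by (auto simp: algebraic_set_def zero_locus_def)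
    ultimately show ?thesis by (simp add: F zero_locus_def)
  qed (use T in auto)
  then show "Z \<subseteq> zariski_closure I S" by (auto simp: zariski_closure_def)
qed

section \<open>Polynomial dependence on a curve parameter\<close>

lemma range_poly_const: "(\<lambda>t. c) \<in> range (poly :: 'a :: comm_ring_1 poly \<Rightarrow> _)"
proof -
  have "(\<lambda>t. c) = poly [:c:]" by auto
  then show ?thesis by blast
qed

lemma range_poly_id: "(\<lambda>t. t) \<in> range (poly :: 'a :: comm_ring_1 poly \<Rightarrow> _)"
proof -
  have "(\<lambda>t :: 'a. t) = poly [:0, 1:]" by auto
  then show ?thesis by blast
qed

lemma range_poly_add:
  assumes "f \<in> range (poly :: 'a :: comm_ring_1 poly \<Rightarrow> _)" "g \<in> range poly"
  shows "(\<lambda>t. f t + g t) \<in> range poly"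
proof -
  obtain p q where "f = poly p" "g = poly q" using assms by blast
  then have "(\<lambda>t. f t + g t) = poly (p + q)" by auto
  then show ?thesis by blast
qed

lemma range_poly_mult:
  assumes "f \<in> range (poly :: 'a :: comm_ring_1 poly \<Rightarrow> _)" "g \<in> range poly"
  shows "(\<lambda>t. f t * g t) \<in> range poly"
proof -
  obtain p q where "f = poly p" "g = poly q" using assms by blast
  then have "(\<lambda>t. f t * g t) = poly (p * q)" by auto
  then show ?thesis by blast
qed

lemma range_poly_coeff_mult:
  assumes "\<And>j. (\<lambda>t. coeff (A t) j) \<in> range (poly :: 'a :: comm_ring_1 poly \<Rightarrow> _)"
    and "\<And>j. (\<lambda>t. coeff (B t) j) \<in> range poly"
  shows "(\<lambda>t. coeff (A t * B t) j) \<in> range poly"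
proof -
  have "(\<lambda>t. \<Sum>i\<in>I. coeff (A t) i * coeff (B t) (j - i)) \<in> range poly" if "finite I" for I
    using that
    by (induction I)
      (simp_all add: range_poly_const range_poly_add range_poly_mult assms)
  then show ?thesis by (simp add: coeff_mult)
qed

section \<open>Monic polynomials with a triple root\<close>

lemma degree_general_poly: "degree (general_poly n a) = n"
  by (intro antisym degree_le le_degree) (auto simp: coeff_general_poly)

lemma lead_coeff_general_poly: "lead_coeff (general_poly n a) = 1"
  by (simp add: degree_general_poly coeff_general_poly)

lemma general_poly_coeffs:
  assumes "degree p = n" "lead_coeff p = 1"
  shows "general_poly n (\<lambda>i\<in>{1..n}. coeff p (n - i)) = p"
  using assms by (intro poly_eqI) (auto simp: coeff_general_poly coeff_eq_0)

lemma triple_root_general_poly_iff: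
  fixes a :: "nat \<Rightarrow> complex"
  assumes "n \<ge> 1"
  shows "order x (general_poly n a) \<ge> 3 \<longleftrightarrow> poly (general_poly n a) x = 0 \<and>
    poly (pderiv (general_poly n a)) x = 0 \<and> poly (pderiv (pderiv (general_poly n a))) x = 0"
  using assms by (intro order_ge_3_iff) (auto simp: pderiv_eq_0_iff degree_general_poly)

text \<open>At 0 the polynomial and its first two derivatives are nonzero multiples of the three
  lowest coefficients; for \<open>n \<ge> 3\<close> none of these is the leading one.\<close>

lemma triple_root_0_general_poly_iff:
  fixes a :: "nat \<Rightarrow> complex"
  assumes "n \<ge> 3"
  shows "order 0 (general_poly n a) \<ge> 3 \<longleftrightarrow> a n = 0 \<and> a (n - 1) = 0 \<and> a (n - 2) = 0"
proof -
  have "order 0 (general_poly n a) \<ge> 3 \<longleftrightarrow> coeff (general_poly n a) 0 = 0 \<and>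
      coeff (general_poly n a) 1 = 0 \<and> coeff (general_poly n a) 2 = 0"
    using assms
    by (subst triple_root_general_poly_iff)
      (simp_all add: poly_0_coeff_0 coeff_pderiv numeral_2_eq_2)
  then show ?thesis using assms by (simp add: coeff_general_poly)
qed

lemma general_poly_upd:
  assumes "1 \<le> k" "k \<le> n"
  shows "general_poly n (b(k := c)) = general_poly n b + monom (c - b k) (n - k)"
  using assms by (intro poly_eqI) (auto simp: coeff_general_poly)

text \<open>The points above \<open>b\<close> are exactly \<open>b(k := c)\<close>, so membership
  reduces to finding one number \<open>c\<close>.\<close>

lemma mem_triple_root_proj_iff:
  assumes "1 \<le> k" "k \<le> n"
  shows "b \<in> triple_root_proj n k \<longleftrightarrow> b \<in> affine_space (coords_without n k) \<and>
    (\<exists>c x. order x (general_poly n (b(k := c))) \<ge> 3)"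
proof
  assume "b \<in> triple_root_proj n k"
  then obtain a x where a: "b = restrict a (coords_without n k)" "a \<in> affine_space {1..n}"
    and x: "order x (general_poly n a) \<ge> 3"
    unfolding triple_root_proj_def triple_root_set_def by blast
  have "general_poly n (b(k := a k)) = general_poly n a"
    using a by (intro poly_eqI) (auto simp: coeff_general_poly coords_without_def)
  then show "b \<in> affine_space (coords_without n k) \<and>
      (\<exists>c x. order x (general_poly n (b(k := c))) \<ge> 3)"
    using a x by (auto simp: affine_space_def) metis
next
  assume b: "b \<in> affine_space (coords_without n k) \<and>
    (\<exists>c x. order x (general_poly n (b(k := c))) \<ge> 3)"
  then obtain c x where "order x (general_poly n (b(k := c))) \<ge> 3" by blast
  moreover from b assms have "b(k := c) \<in> affine_space {1..n}"
    by (auto simp: affine_space_def coords_without_def PiE_iff extensional_def)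
  moreover from b have "b = restrict (b(k := c)) (coords_without n k)"
    by (auto simp: affine_space_def coords_without_def PiE_iff extensional_def fun_eq_iff)
  ultimately show "b \<in> triple_root_proj n k"
    unfolding triple_root_proj_def triple_root_set_def by blast
qed

section \<open>Irreducibility of the projections\<close>

text \<open>Interpolating the root and the cofactor separately keeps the triple root. Both cofactors
  are monic of degree \<open>n - 3\<close>, hence so is their interpolation, and every
  \<open>A t\<close> is again monic of degree \<open>n\<close>.\<close>

lemma triple_root_set_curve:
  assumes "a \<in> triple_root_set n" "b \<in> triple_root_set n"
  shows "\<exists>c. (\<forall>t. (\<lambda>i. poly (c i) t) \<in> triple_root_set n) \<and>
    (\<lambda>i. poly (c i) 0) = a \<and> (\<lambda>i. poly (c i) 1) = b"
proof -
  obtain x y where x: "order x (general_poly n a) \<ge> 3" and y: "order y (general_poly n b) \<ge> 3"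
    using assms by (auto simp: triple_root_set_def)
  obtain Q where Q: "general_poly n a = [:- x, 1:] ^ 3 * Q"
    using x order_divides[of x 3 "general_poly n a"] by (auto elim: dvdE)
  obtain R where R: "general_poly n b = [:- y, 1:] ^ 3 * R"
    using y order_divides[of y 3 "general_poly n b"] by (auto elim: dvdE)
  have monic: "degree S + 3 = n \<and> lead_coeff S = 1"
    if "general_poly n d = [:- z, 1:] ^ 3 * S" for d z and S :: "complex poly"
  proof -
    have "lead_coeff S = 1"
      using lead_coeff_general_poly[of n d] by (simp add: that lead_coeff_mult lead_coeff_power)
    moreover from this have "S \<noteq> 0" by auto
    then have "degree S + 3 = n"
      using degree_general_poly[of n d]
      by (simp add: that degree_mult_eq degree_power_eq)
    ultimately show ?thesis by blast
  qed
  note Q' = monic[OF Q] and R' = monic[OF R]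
  define z where "z t = x + t * (y - x)" for t
  define S where "S t = Q + smult t (R - Q)" for t
  define A where "A t = [:- z t, 1:] ^ 3 * S t" for t
  have S: "degree (S t) = n - 3" "lead_coeff (S t) = 1" for t
  proof -
    have d: "degree Q = n - 3" "degree R = n - 3" and l: "coeff Q (n - 3) = 1" "coeff R (n - 3) = 1"
      using Q' R' by auto
    \<comment> \<open>The leading terms of \<open>Q\<close> and \<open>R\<close> agree, so
      \<open>R - Q\<close> does not contribute in this degree.\<close>
    have 1: "coeff (S t) (n - 3) = 1" by (simp add: S_def l)
    have "degree (S t) \<le> n - 3"
      unfolding S_def by (intro degree_add_le degree_diff_le order_trans[OF degree_smult_le])
        (simp_all add: d)
    moreover have "n - 3 \<le> degree (S t)" using 1 by (intro le_degree) simp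
    ultimately show "degree (S t) = n - 3" by simp
    with 1 show "lead_coeff (S t) = 1" by simp
  qed
  have A: "degree (A t) = n" "lead_coeff (A t) = 1" for t
  proof -
    have "S t \<noteq> 0" using S(2)[of t] by auto
    then show "degree (A t) = n"
      using S(1)[of t] Q' by (simp add: A_def degree_mult_eq degree_power_eq)
    show "lead_coeff (A t) = 1"
      using S(2)[of t] by (simp add: A_def lead_coeff_mult lead_coeff_power)
  qed
  have lin: "(\<lambda>t. coeff [:- z t, 1:] j) \<in> range poly" for j
  proof -
    have "(\<lambda>t. - z t) = poly [:- x, x - y:]" by (auto simp: z_def algebra_simps)
    then have "(\<lambda>t. - z t) \<in> range poly" by blast
    then show ?thesis
      by (cases j) (simp_all add: range_poly_const)
  qed
  have "(\<lambda>t. coeff (S t) j) \<in> range poly" for j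
    unfolding S_def coeff_add coeff_smult
    by (intro range_poly_add range_poly_mult range_poly_id range_poly_const)
  then have "(\<lambda>t. coeff (A t) j) \<in> range poly" for j
    unfolding A_def power3_eq_cube by (intro range_poly_coeff_mult lin)
  then have "\<exists>p. \<forall>t. coeff (A t) j = poly p t" for j by (metis rangeE)
  then obtain g where g: "\<And>j t. coeff (A t) j = poly (g j) t" by metis
  \<comment> \<open>Points are extensional functions, so the curve has to be constantly
    \<open>undefined\<close> outside the index set.\<close>
  define c where "c i = (if i \<in> {1..n} then g (n - i) else [:undefined:])" for i
  have c: "(\<lambda>i. poly (c i) t) = (\<lambda>i\<in>{1..n}. coeff (A t) (n - i))" for t
    by (auto simp: c_def g)
  have "(\<lambda>i. poly (c i) t) \<in> triple_root_set n" for t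
  proof -
    have "A t \<noteq> 0" using A(2)[of t] by auto
    moreover have "[:- z t, 1:] ^ 3 dvd A t" by (simp add: A_def)
    ultimately have "order (z t) (A t) \<ge> 3" using order_divides by blast
    then show ?thesis
      unfolding triple_root_set_def c using general_poly_coeffs[OF A]
      by (auto simp: affine_space_def)
  qed
  moreover have ends: "(\<lambda>i. poly (c i) t) = d"
    if "A t = general_poly n d" "d \<in> triple_root_set n" for t d
    using that unfolding c
    by (auto simp: coeff_general_poly triple_root_set_def affine_space_def PiE_iff
        extensional_def fun_eq_iff)
  moreover have "A 0 = general_poly n a" "A 1 = general_poly n b"
    by (simp_all add: A_def z_def S_def Q R)
  ultimately show ?thesis using assms by blast
qed

text \<open>Forgetting a coordinate maps polynomial curves to polynomial curves.\<close>

lemma triple_root_proj_curve: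
  assumes "p \<in> triple_root_proj n k" "q \<in> triple_root_proj n k"
  shows "\<exists>c. (\<forall>t. (\<lambda>i. poly (c i) t) \<in> triple_root_proj n k) \<and>
    (\<lambda>i. poly (c i) 0) = p \<and> (\<lambda>i. poly (c i) 1) = q"
proof -
  let ?r = "\<lambda>a. restrict a (coords_without n k)"
  obtain a b where p: "p = ?r a" "a \<in> triple_root_set n" and q: "q = ?r b" "b \<in> triple_root_set n"
    using assms by (auto simp: triple_root_proj_def)
  obtain c where c: "\<And>t. (\<lambda>i. poly (c i) t) \<in> triple_root_set n"
    "(\<lambda>i. poly (c i) 0) = a" "(\<lambda>i. poly (c i) 1) = b"
    using triple_root_set_curve[OF p(2) q(2)] by blast
  define d where "d i = (if i \<in> coords_without n k then c i else [:undefined:])" for i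
  have d: "(\<lambda>i. poly (d i) t) = ?r (\<lambda>i. poly (c i) t)" for t
    by (auto simp: d_def)
  then have "(\<lambda>i. poly (d i) t) \<in> triple_root_proj n k" for t
    using c(1)[of t] unfolding triple_root_proj_def d by blast
  moreover have "(\<lambda>i. poly (d i) 0) = p" "(\<lambda>i. poly (d i) 1) = q"
    unfolding d c p q by simp_all
  ultimately show ?thesis by blast
qed

lemma zariski_irreducible_triple_root_proj:
  assumes "1 \<le> k" "k \<le> n" "n \<ge> 3"
  shows "zariski_irreducible (coords_without n k) (triple_root_proj n k)"
proof (rule zariski_irreducible_if_curves)
  \<comment> \<open>The polynomial \<open>x ^ n\<close> witnesses that the projection is
    nonempty.\<close>
  have "order 0 (general_poly n (\<lambda>i\<in>{1..n}. 0 :: complex)) \<ge> 3"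
    using assms by (subst triple_root_0_general_poly_iff) auto
  then have "(\<lambda>i\<in>{1..n}. 0) \<in> triple_root_set n"
    by (auto simp: triple_root_set_def affine_space_def)
  then show "triple_root_proj n k \<noteq> {}" by (auto simp: triple_root_proj_def)
  show "triple_root_proj n k \<subseteq> affine_space (coords_without n k)"
    using mem_triple_root_proj_iff assms by blast
qed (rule triple_root_proj_curve)

section \<open>The polynomials \<open>P_k\<close> at a point\<close>

text \<open>This is the specialization of \<open>P_red n k\<close> at the point \<open>b\<close>, as
  \<open>map_poly_P_red\<close> confirms.\<close>

definition P_at :: "nat \<Rightarrow> nat \<Rightarrow> (nat \<Rightarrow> complex) \<Rightarrow> complex poly" where
  "P_at n k b = (if k = n then pderiv (general_poly n b)
     else general_poly n b - smult (1 / of_nat (n - k)) (pCons 0 (pderiv (general_poly n b))))"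

text \<open>Passing from \<open>P\<close> to \<open>P - x P' / (n - k)\<close> acts diagonally on
  the powers of \<open>x\<close>. The factor vanishes exactly at \<open>j = n - k\<close>, the place
  of the coefficient \<open>b k\<close>.\<close>

lemma coeff_P_at:
  assumes "1 \<le> k" "k < n"
  shows "coeff (P_at n k b) j =
    (1 - of_nat j / of_nat (n - k)) * (if j = n then 1 else if j < n then b (n - j) else 0)"
proof -
  have "coeff (smult s (pCons 0 (pderiv p))) j = s * (of_nat j * coeff p j)"
    for s and p :: "complex poly"
    by (cases j) (simp_all add: coeff_pderiv)
  then have "coeff (P_at n k b) j = (1 - of_nat j / of_nat (n - k)) * coeff (general_poly n b) j"
    using assms by (simp only: P_at_def coeff_diff left_diff_distrib) simp
  then show ?thesis by (simp only: coeff_general_poly)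
qed

lemma coeff_P_red_self:
  "coeff (P_red n n) j = mconst (of_nat (Suc j)) *
     (if Suc j = n then 1 else if Suc j < n then mvar (n - Suc j) else 0)"
proof -
  have "mconst (of_nat m) = of_nat m" for m by (simp add: mconst_def)
  then show ?thesis
    by (simp add: P_red_def P_gen_def coeff_pderiv coeff_general_poly del: of_nat_Suc)
qed

text \<open>For \<open>k < n\<close> the coefficient \<open>b k\<close> is multiplied by 0; for
  \<open>k = n\<close> it is the constant term, which the derivative kills.\<close>

lemma P_at_upd:
  assumes "1 \<le> k" "k \<le> n"
  shows "P_at n k (b(k := c)) = P_at n k b"
proof (cases "k = n")
  case True
  with assms show ?thesis
    by (intro poly_eqI) (auto simp: P_at_def coeff_pderiv coeff_general_poly)
next
  case False
  with assms have k: "1 \<le> k" "k < n" by auto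
  then have *: "1 - of_nat j / of_nat (n - k) = (0 :: complex)" if "j < n" "n - j = k" for j
    using that by auto
  show ?thesis
    by (intro poly_eqI) (auto simp: coeff_P_at[OF k] dest: *)
qed

text \<open>The leading coefficient is \<open>n\<close> for \<open>k = n\<close> and
  \<open>- k / (n - k)\<close> otherwise.\<close>

lemma P_at_neq_0:
  assumes "1 \<le> k" "k \<le> n"
  shows "P_at n k b \<noteq> 0"
proof (cases "k = n")
  case True
  with assms show ?thesis by (simp add: P_at_def pderiv_eq_0_iff degree_general_poly)
next
  case False
  with assms have k: "1 \<le> k" "k < n" by auto
  then have "(of_nat n :: complex) \<noteq> of_nat (n - k)" "(of_nat (n - k) :: complex) \<noteq> 0" by auto
  then have "coeff (P_at n k b) n \<noteq> 0" by (simp add: coeff_P_at[OF k])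
  then show ?thesis by auto
qed

lemma map_poly_P_red:
  assumes "1 \<le> k" "k \<le> n"
  shows "map_poly (\<lambda>f. meval f b) (P_red n k) = P_at n k b"
proof (cases "k = n")
  case True
  then show ?thesis
    by (intro poly_eqI)
      (simp add: coeff_map_poly coeff_P_red_self P_at_def coeff_pderiv coeff_general_poly
        meval_mult meval_mvar)
next
  case False
  with assms have k: "1 \<le> k" "k < n" by auto
  show ?thesis
    by (intro poly_eqI)
      (simp add: coeff_map_poly coeff_P_red[OF k] coeff_P_at[OF k] meval_mult meval_mvar)
qed

lemma map_poly_meval_pderiv:
  "map_poly (\<lambda>f. meval f b) (pderiv p) = pderiv (map_poly (\<lambda>f. meval f b) p)"
proof -
  have "meval (of_nat m) b = of_nat m" for m
    using meval_mconst[of "of_nat m" b] by (simp add: mconst_def)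
  then show ?thesis
    by (intro poly_eqI) (simp add: coeff_map_poly coeff_pderiv meval_mult del: of_nat_Suc)
qed

section \<open>Specialization of \<open>V_k\<close>\<close>

text \<open>A nonzero constant leading coefficient survives every evaluation. This supplies the
  degree conditions of \<open>meval_resultant\<close>.\<close>

lemma degree_map_poly_meval:
  assumes "lead_coeff p \<in> range mconst"
  shows "degree (map_poly (\<lambda>f. meval f b) p) = degree p"
proof (cases "p = 0")
  case False
  obtain c where c: "lead_coeff p = mconst c" using assms by blast
  with False have "mconst c \<noteq> 0" by (metis leading_coeff_0_iff)
  then have "coeff (map_poly (\<lambda>f. meval f b) p) (degree p) \<noteq> 0"
    by (simp add: coeff_map_poly c)
  then show ?thesis by (intro antisym degree_map_poly_le le_degree)
qed simp

lemma lead_coeff_pderiv_const: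
  assumes "lead_coeff p \<in> range mconst"
  shows "lead_coeff (pderiv p) \<in> range mconst"
proof (cases "pderiv p = 0")
  case True
  then show ?thesis by (intro range_eqI[of _ _ 0]) (simp add: mconst_def)
next
  case False
  obtain c where c: "lead_coeff p = mconst c" using assms by blast
  define d where "d = degree p"
  have d: "d > 0"
  proof (rule ccontr)
    assume "\<not> d > 0"
    then have "degree p = 0" by (simp add: d_def)
    then obtain e where "p = [:e:]" by (rule degree_eq_zeroE)
    with False show False by (simp add: pderiv_pCons)
  qed
  have p: "p \<noteq> 0" using False by auto
  have "coeff (pderiv p) (d - 1) = of_nat d * mconst c"
    using d c by (simp add: coeff_pderiv d_def)
  also have "\<dots> = mconst (of_nat d * c)"
    by (simp add: mconst_def mult_single flip: single_of_nat)
  finally have e: "coeff (pderiv p) (d - 1) = mconst (of_nat d * c)" .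
  have "mconst c \<noteq> 0" using p c by (metis leading_coeff_0_iff)
  with d have "mconst (of_nat d * c) \<noteq> 0" by simp
  then have "d - 1 \<le> degree (pderiv p)" unfolding e[symmetric] by (rule le_degree)
  moreover have "degree (pderiv p) \<le> d - 1"
    by (intro degree_le) (auto simp: coeff_pderiv d_def intro!: coeff_eq_0)
  ultimately show ?thesis using e by (metis antisym rangeI)
qed

lemma lead_coeff_P_red:
  assumes "1 \<le> k" "k \<le> n"
  shows "lead_coeff (P_red n k) \<in> range mconst"
proof (cases "k = n")
  case True
  have 1: "1 \<in> range mconst" by (rule range_eqI[of _ _ 1]) (simp add: mconst_def)
  show ?thesis
    using lead_coeff_pderiv_const[of "P_gen n"] True 1
    by (simp add: P_red_def P_gen_def lead_coeff_general_poly)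
next
  case False
  with assms have k: "1 \<le> k" "k < n" by auto
  have "(of_nat n :: complex) \<noteq> of_nat (n - k)" "(of_nat (n - k) :: complex) \<noteq> 0"
    using k by auto
  then have "degree (P_red n k) = n"
    by (intro antisym degree_le le_degree) (auto simp: coeff_P_red[OF k])
  then show ?thesis by (simp add: coeff_P_red[OF k])
qed

text \<open>
  For \<open>k = n - 1\<close> the derivative has no constant term, and factoring \<open>x\<close> out of it splits
  the last indeterminate off the resultant.
\<close>

lemma V_red_resultant:
  assumes "1 \<le> k" "k \<le> n"
  obtains R where "pderiv (P_red n k) = (if Suc k = n then pCons 0 R else R)"
    and "lead_coeff R \<in> range mconst"
    and "V_red n k = resultant (P_red n k) R \<or> V_red n k = - resultant (P_red n k) R"
proof (cases "Suc k = n")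
  case False
  then show ?thesis
    using assms that[of "pderiv (P_red n k)"]
    by (simp add: V_red_def Res_red_def lead_coeff_pderiv_const lead_coeff_P_red)
next
  case True
  then have k: "1 \<le> k" "k < n" "n - k = 1" "k = n - 1" using assms by auto
  obtain c R where cR: "pderiv (P_red n k) = pCons c R" by (cases "pderiv (P_red n k)")
  have "c = coeff (pderiv (P_red n k)) 0" by (simp add: cR)
  also have "\<dots> = 0"
    using k(3) by (simp add: coeff_pderiv coeff_P_red[OF k(1,2)] del: One_nat_def)
  finally have R: "pderiv (P_red n k) = pCons 0 R" using cR by simp
  have "R \<noteq> 0" using degree_pderiv_P_red[OF k(1,2)] by (auto simp: R)
  then have lead: "lead_coeff R \<in> range mconst"
    using lead_coeff_pderiv_const[OF lead_coeff_P_red[OF assms]] by (simp add: R)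
  have "coeff (P_red n k) 0 = mvar n"
    using coeff_P_red[OF k(1,2), of 0] k(1,2) by (simp add: mconst_def)
  then have "Res_red n k = (- 1) ^ degree (P_red n k) * mvar n * resultant (P_red n k) R"
    unfolding Res_red_def R using resultant_pCons_0[OF \<open>R \<noteq> 0\<close>] by simp
  moreover have "Res_red n k = V_red n k * mvar n"
    using V_red_penultimate(2)[of n] k by simp
  ultimately have "V_red n k * mvar n = ((- 1) ^ degree (P_red n k) * resultant (P_red n k) R) * mvar n"
    by (simp add: mult_ac)
  then have "V_red n k = (- 1) ^ degree (P_red n k) * resultant (P_red n k) R"
    by (simp only: mult_cancel_right mvar_neq_0 simp_thms)
  then have "V_red n k = resultant (P_red n k) R \<or> V_red n k = - resultant (P_red n k) R"
    by (cases "even (degree (P_red n k))") simp_all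
  with that[of R] R lead True show ?thesis by simp
qed

lemma meval_uminus: "meval (- f) b = - meval f b"
  using meval_add[of f "- f" b] by (simp add: eq_neg_iff_add_eq_0 add.commute)

text \<open>Up to sign \<open>V_red n k\<close> is a resultant of polynomials with constant leading
  coefficients, so it specializes to the resultant of \<open>P_at n k b\<close> and
  \<open>R\<close>. Here \<open>R\<close> is the derivative, divided by \<open>x\<close> if
  \<open>k = n - 1\<close>.\<close>

lemma meval_V_red_eq_0_iff:
  assumes "1 \<le> k" "k \<le> n"
  obtains R where "pderiv (P_at n k b) = (if Suc k = n then pCons 0 R else R)"
    and "meval (V_red n k) b = 0 \<longleftrightarrow> (\<exists>x. poly (P_at n k b) x = 0 \<and> poly R x = 0)"
proof -
  let ?m = "map_poly (\<lambda>f. meval f b)"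
  obtain R where R: "pderiv (P_red n k) = (if Suc k = n then pCons 0 R else R)"
    "lead_coeff R \<in> range mconst"
    "V_red n k = resultant (P_red n k) R \<or> V_red n k = - resultant (P_red n k) R"
    using V_red_resultant[OF assms] by blast
  have "?m (pderiv (P_red n k)) = pderiv (P_at n k b)"
    by (simp add: map_poly_meval_pderiv map_poly_P_red[OF assms])
  moreover have "?m (pCons 0 R) = pCons 0 (?m R)"
    by (intro poly_eqI) (simp add: coeff_map_poly coeff_pCons split: nat.split)
  ultimately have "pderiv (P_at n k b) = (if Suc k = n then pCons 0 (?m R) else ?m R)"
    by (simp add: R(1) split: if_splits)
  moreover have "meval (V_red n k) b = 0 \<longleftrightarrow> meval (resultant (P_red n k) R) b = 0"
    using R(3) by (auto simp: meval_uminus)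
  moreover have "meval (resultant (P_red n k) R) b = resultant (P_at n k b) (?m R)"
    using meval_resultant[OF degree_map_poly_meval[OF lead_coeff_P_red[OF assms]]
        degree_map_poly_meval[OF R(2)]]
    by (simp only: map_poly_P_red[OF assms])
  ultimately show ?thesis
    using that resultant_eq_0_iff_common_root[OF P_at_neq_0[OF assms]] by simp
qed

text \<open>The indeterminate \<open>mvar k\<close> does not occur in the coefficients of
  \<open>P_red n k\<close>. For \<open>k = n - 1\<close> the quotient inherits this through its
  description as a resultant.\<close>

lemma mvars_V_red:
  assumes "1 \<le> k" "k \<le> n"
  shows "mvars (V_red n k) \<subseteq> coords_without n k"
proof -
  let ?I = "coords_without n k"
  have c: "mvars (coeff (P_red n k) j) \<subseteq> ?I" for j
  proof (cases "k = n")
    case True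
    have "mvars (if Suc j = n then 1 else if Suc j < n then mvar (n - Suc j) else 0) \<subseteq> ?I"
      using True by (auto simp: coords_without_def)
    then show ?thesis
      unfolding True coeff_P_red_self using mvars_mult mvars_const by blast
  next
    case False
    with assms have k: "1 \<le> k" "k < n" by auto
    show ?thesis
    proof (cases "j = n - k")
      case True
      then have "coeff (P_red n k) j = 0" using k by (simp add: coeff_P_red[OF k])
      then show ?thesis by simp
    next
      case False
      then have "mvars (if j = n then 1 else if j < n then mvar (n - j) else 0) \<subseteq> ?I"
        using k by (auto simp: coords_without_def)
      then show ?thesis
        unfolding coeff_P_red[OF k] using mvars_mult mvars_const by blast
    qed
  qed
  have p: "mvars (coeff (pderiv (P_red n k)) j) \<subseteq> ?I" for j
    unfolding coeff_pderiv using mvars_mult mvars_of_nat c by blast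
  obtain R where R: "pderiv (P_red n k) = (if Suc k = n then pCons 0 R else R)"
    "V_red n k = resultant (P_red n k) R \<or> V_red n k = - resultant (P_red n k) R"
    using V_red_resultant[OF assms] by blast
  \<comment> \<open>The coefficients of \<open>R\<close> are those of the derivative, shifted by one
    if \<open>k = n - 1\<close>.\<close>
  have "mvars (coeff R j) \<subseteq> ?I" for j
    using p[of j] p[of "Suc j"] R(1) by (simp split: if_splits)
  then have "mvars (resultant (P_red n k) R) \<subseteq> ?I" by (intro mvars_resultant c)
  with R(2) show ?thesis by auto
qed

section \<open>Double roots of \<open>P_k\<close> and triple roots of \<open>P\<close>\<close>

lemma poly_P_at:
  assumes "k \<noteq> n"
  shows "poly (P_at n k b) x =
      poly (general_poly n b) x - x * poly (pderiv (general_poly n b)) x / of_nat (n - k)"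
    and "poly (pderiv (P_at n k b)) x =
      poly (pderiv (general_poly n b)) x - (poly (pderiv (general_poly n b)) x +
        x * poly (pderiv (pderiv (general_poly n b))) x) / of_nat (n - k)"
  using assms
  by (simp_all add: P_at_def pderiv_diff pderiv_smult pderiv_pCons add_divide_distrib)

text \<open>At a triple root \<open>P\<close>, \<open>P'\<close> and \<open>P''\<close> vanish, and
  the values of \<open>P_k\<close> and \<open>P_k'\<close> are combinations of theirs. By
  \<open>P_at_upd\<close> the value \<open>c\<close> does not matter for \<open>P_k\<close>.\<close>

lemma P_at_double_root_if_triple_root:
  assumes "1 \<le> k" "k \<le> n" "order x (general_poly n (b(k := c))) \<ge> 3"
  shows "poly (P_at n k b) x = 0" "poly (pderiv (P_at n k b)) x = 0"
proof -
  let ?P = "general_poly n (b(k := c))"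
  have "poly ?P x = 0" "poly (pderiv ?P) x = 0" "poly (pderiv (pderiv ?P)) x = 0"
    using assms by (auto simp: triple_root_general_poly_iff)
  then have "poly (P_at n k (b(k := c))) x = 0 \<and> poly (pderiv (P_at n k (b(k := c)))) x = 0"
    by (cases "k = n") (simp add: P_at_def, simp add: poly_P_at)
  then show "poly (P_at n k b) x = 0" "poly (pderiv (P_at n k b)) x = 0"
    using assms by (simp_all add: P_at_upd)
qed

text \<open>The coefficient missing from \<open>P_at\<close> is free to be chosen so that \<open>x\<close> is a root of \<open>P\<close>.\<close>

lemma triple_root_if_P_at_double_root:
  assumes "1 \<le> k" "k \<le> n" "x \<noteq> 0 \<or> k = n"
    and "poly (P_at n k b) x = 0" "poly (pderiv (P_at n k b)) x = 0"
  shows "\<exists>c. order x (general_poly n (b(k := c))) \<ge> 3"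
proof -
  \<comment> \<open>Replacing \<open>b k\<close> by \<open>c\<close> adds
    \<open>(c - b k) * x ^ (n - k)\<close> to the value at \<open>x\<close>. For
    \<open>k = n\<close> the power is 1, so \<open>x = 0\<close> is allowed.\<close>
  define c where "c = b k - poly (general_poly n b) x / x ^ (n - k)"
  let ?P = "general_poly n (b(k := c))"
  have 0: "poly ?P x = 0"
    using assms by (auto simp: general_poly_upd poly_monom c_def)
  have d: "poly (P_at n k (b(k := c))) x = 0" "poly (pderiv (P_at n k (b(k := c)))) x = 0"
    using assms by (simp_all add: P_at_upd)
  have "poly (pderiv ?P) x = 0 \<and> poly (pderiv (pderiv ?P)) x = 0"
  proof (cases "k = n")
    case True
    with d show ?thesis by (simp add: P_at_def)
  next
    case False
    with assms have x: "x \<noteq> 0" "(of_nat (n - k) :: complex) \<noteq> 0" by auto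
    \<comment> \<open>As \<open>P(x) = 0\<close>, only the term with \<open>P'\<close> remains in
      \<open>P_k(x)\<close>; after that, only the term with \<open>P''\<close> remains in
      \<open>P_k'(x)\<close>.\<close>
    have "x * poly (pderiv ?P) x / of_nat (n - k) = 0"
      using d(1) 0 False by (simp add: poly_P_at)
    with x have "poly (pderiv ?P) x = 0" by simp
    with d(2) x False show ?thesis by (simp add: poly_P_at)
  qed
  with 0 assms show ?thesis by (auto simp: triple_root_general_poly_iff)
qed

section \<open>The projection and the zero locus of \<open>V_k\<close>\<close>

lemma triple_root_proj_subset:
  assumes "1 \<le> k" "k \<le> n"
  shows "triple_root_proj n k \<subseteq> zero_locus (coords_without n k) {V_red n k}"
proof
  fix b assume b: "b \<in> triple_root_proj n k"
  then obtain c x where x: "order x (general_poly n (b(k := c))) \<ge> 3"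
    using mem_triple_root_proj_iff[OF assms] by blast
  obtain R where R: "pderiv (P_at n k b) = (if Suc k = n then pCons 0 R else R)"
    "meval (V_red n k) b = 0 \<longleftrightarrow> (\<exists>x. poly (P_at n k b) x = 0 \<and> poly R x = 0)"
    using meval_V_red_eq_0_iff[OF assms] by blast
  note d = P_at_double_root_if_triple_root[OF assms x]
  have "poly R x = 0"
  \<comment> \<open>In this case \<open>P_k' = x R\<close>, so \<open>P_k'(0) = 0\<close> says
    nothing about \<open>R(0)\<close>. Instead, \<open>R(0)\<close> is the coefficient of
    \<open>x\<close> in \<open>P_k'\<close>, which equals \<open>- P''(0)\<close>.\<close>
  proof (cases "Suc k = n \<and> x = 0")
    case True
    then have k: "1 \<le> k" "k < n" "n - k = 1" using assms by auto
    have "poly R x = coeff (pderiv (P_at n k b)) 1"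
      using True by (simp add: R poly_0_coeff_0)
    also have "\<dots> = - coeff (pderiv (pderiv (general_poly n (b(k := c))))) 0"
      using k by (auto simp: coeff_pderiv coeff_P_at[OF k(1,2)] coeff_general_poly numeral_2_eq_2)
    also have "\<dots> = 0"
      using x True assms triple_root_general_poly_iff[of n x "b(k := c)"] by (simp add: poly_0_coeff_0)
    finally show ?thesis .
  qed (use d(2) in \<open>auto simp: R split: if_splits\<close>)
  with d(1) R(2) have "meval (V_red n k) b = 0" by blast
  with b show "b \<in> zero_locus (coords_without n k) {V_red n k}"
    using mem_triple_root_proj_iff[OF assms] by (simp add: zero_locus_def)
qed

text \<open>A common root \<open>x\<close> lifts to a triple root if \<open>x\<close> is nonzero or
  \<open>k = n\<close>. Otherwise \<open>x = 0\<close> and \<open>b n = 0\<close>. For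
  \<open>k = n - 1\<close> the condition \<open>R(0) = 0\<close> gives \<open>b (n - 2) = 0\<close>;
  for \<open>k = n - 2\<close> the double root gives \<open>b (n - 1) = 0\<close>; the remaining low
  coefficient is free. For smaller \<open>k\<close> the given \<open>b (n - 2)\<close> may be
  nonzero, which leaves the second alternative.\<close>

lemma zero_locus_V_red_cases:
  assumes "1 \<le> k" "k \<le> n" "b \<in> zero_locus (coords_without n k) {V_red n k}"
  shows "b \<in> triple_root_proj n k \<or> k + 3 \<le> n \<and> b n = 0 \<and> b (n - 1) = 0"
proof -
  have b: "b \<in> affine_space (coords_without n k)" "meval (V_red n k) b = 0"
    using assms by (auto simp: zero_locus_def)
  obtain R where R: "pderiv (P_at n k b) = (if Suc k = n then pCons 0 R else R)"
    "meval (V_red n k) b = 0 \<longleftrightarrow> (\<exists>x. poly (P_at n k b) x = 0 \<and> poly R x = 0)"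
    using meval_V_red_eq_0_iff[OF assms(1,2)] by blast
  obtain x where x: "poly (P_at n k b) x = 0" "poly R x = 0" using b R by blast
  then have d: "poly (pderiv (P_at n k b)) x = 0" by (simp add: R)
  show ?thesis
  proof (cases "x \<noteq> 0 \<or> k = n")
    case True
    then show ?thesis
      using triple_root_if_P_at_double_root[OF assms(1,2) _ x(1) d] b
        mem_triple_root_proj_iff[OF assms(1,2)] by blast
  next
    case False
    with assms have k: "1 \<le> k" "k < n" and x0: "x = 0" by auto
    have bn: "b n = 0" using x(1) k by (simp add: x0 poly_0_coeff_0 coeff_P_at)
    have d0: "coeff (pderiv (P_at n k b)) 0 = 0" using d by (simp add: x0 poly_0_coeff_0)
    \<comment> \<open>With the missing coefficient set to 0, the root to be made triple is 0
      itself.\<close>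
    have *: ?thesis if "n \<ge> 3" "(b(k := 0)) (n - 1) = 0" "(b(k := 0)) (n - 2) = 0"
    proof -
      have "order 0 (general_poly n (b(k := 0))) \<ge> 3"
        using that k bn by (subst triple_root_0_general_poly_iff) auto
      then show ?thesis using b mem_triple_root_proj_iff[OF assms(1,2)] by blast
    qed
    show ?thesis
    proof (cases "Suc k = n")
      case True
      have "coeff (pderiv (P_at n k b)) 1 = 0"
        using x True by (simp add: x0 poly_0_coeff_0 R)
      then have 2: "coeff (P_at n k b) 2 = 0" by (simp add: coeff_pderiv numeral_2_eq_2)
      \<comment> \<open>For \<open>n = 2\<close> the coefficient of \<open>x ^ 2\<close> comes from
        the leading term and equals -1.\<close>
      have n: "n \<ge> 3"
      proof (rule ccontr)
        assume "\<not> n \<ge> 3"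
        with True k have "n = 2" "k = 1" by auto
        with 2 show False by (simp add: coeff_P_at)
      qed
      moreover have "n - k = 1" using True by simp
      ultimately have "b (n - 2) = 0" using 2 k by (simp add: coeff_P_at)
      then show ?thesis using * n True by auto
    next
      case False
      with k have n: "n - k \<noteq> 1" "n - k \<noteq> 0" "n \<ge> 3" by auto
      \<comment> \<open>Hence the factor \<open>1 - 1 / (n - k)\<close> of \<open>b (n - 1)\<close>
        in \<open>P_k\<close> is nonzero.\<close>
      then have "(of_nat (n - k) :: complex) \<noteq> of_nat 1" unfolding of_nat_eq_iff by simp
      with n have b1: "b (n - 1) = 0"
        using d0 k by (simp add: coeff_pderiv coeff_P_at del: of_nat_diff)
      show ?thesis
      proof (cases "k + 2 = n")
        case True
        then show ?thesis using * b1 \<open>n \<ge> 3\<close> by auto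
      next
        case F: False
        then show ?thesis using False k bn b1 by auto
      qed
    qed
  qed
qed

text \<open>
  The curve prescribes the double root \<open>t\<close>: the two lowest coefficients of \<open>P_at\<close> are
  replaced by the values that cancel the value and the slope of the rest at \<open>t\<close>.
\<close>

lemma triple_root_proj_limit_curve:
  assumes "1 \<le> k" "k + 2 \<le> n" "z \<in> affine_space (coords_without n k)" "z n = 0" "z (n - 1) = 0"
  shows "\<exists>c. (\<forall>t. t \<noteq> 0 \<longrightarrow> (\<lambda>i. poly (c i) t) \<in> triple_root_proj n k) \<and>
    (\<lambda>i. poly (c i) 0) = z"
proof -
  have k: "1 \<le> k" "k < n" "k \<le> n" using assms by auto
  define h where "h = P_at n k z"
  \<comment> \<open>This is the factor with which the coordinate \<open>n - 1\<close> enters the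
    coefficient of \<open>x\<close> in \<open>P_k\<close>.\<close>
  define s :: complex where "s = 1 - 1 / of_nat (n - k)"
  have "(of_nat (n - k) :: complex) \<noteq> of_nat 1" using assms unfolding of_nat_eq_iff by auto
  then have s: "s \<noteq> 0" using assms by (simp add: s_def)
  \<comment> \<open>These two coordinates subtract from \<open>h\<close> its tangent line at
    \<open>t\<close>. At \<open>t = 0\<close> this line is zero, because \<open>h\<close> has a
    double root there, and the curve passes through \<open>z\<close>.\<close>
  define c where "c i = (if i = n then pCons 0 (pderiv h) - h
    else if i = n - 1 then smult (- 1 / s) (pderiv h) else [:z i:])" for i
  have h0: "coeff h 0 = 0" "coeff h 1 = 0"
    using assms k by (simp_all add: h_def coeff_P_at)
  have "(\<lambda>i. poly (c i) 0) = z"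
    using assms h0 by (auto simp: c_def poly_0_coeff_0 coeff_pderiv)
  moreover have "(\<lambda>i. poly (c i) t) \<in> triple_root_proj n k" if t: "t \<noteq> 0" for t
  proof -
    let ?b = "\<lambda>i. poly (c i) t"
    let ?h = "poly h t" and ?h' = "poly (pderiv h) t"
    have P: "P_at n k ?b = h + [:t * ?h' - ?h, - ?h':]"
    proof (rule poly_eqI)
      fix j :: nat
      consider "j = 0" | "j = 1" | "j \<ge> 2" by linarith
      then show "coeff (P_at n k ?b) j = coeff (h + [:t * ?h' - ?h, - ?h':]) j"
      proof cases
        case 1
        then show ?thesis using k h0 by (simp add: coeff_P_at c_def)
      next
        case 2
        have "coeff (P_at n k ?b) 1 = s * poly (c (n - 1)) t"
          using k assms by (simp add: coeff_P_at s_def)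
        also have "\<dots> = - ?h'" using s k by (auto simp: c_def)
        finally show ?thesis using 2 h0 by simp
      next
        case 3
        then have "coeff [:t * ?h' - ?h, - ?h':] j = 0" by (intro coeff_eq_0) auto
        moreover have "coeff (P_at n k ?b) j = coeff h j"
          using k 3 by (auto simp: coeff_P_at h_def c_def)
        ultimately show ?thesis by simp
      qed
    qed
    have "\<exists>d. order t (general_poly n (?b(k := d))) \<ge> 3"
      using t k by (intro triple_root_if_P_at_double_root)
        (simp_all add: P pderiv_add pderiv_pCons)
    moreover have "?b \<in> affine_space (coords_without n k)"
      using assms
      by (auto simp: affine_space_def coords_without_def c_def PiE_iff extensional_def)
    ultimately show ?thesis using mem_triple_root_proj_iff[OF k(1,3)] by blast
  qed
  ultimately show ?thesis by blast
qed

text \<open>For \<open>k \<le> n - 3\<close> the projection can miss points of the zero locus, so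
  \<open>V_k = 0\<close> describes its closure there. For \<open>n < 3\<close> there are no triple
  roots, and the empty set does not count as irreducible.\<close>

theorem theorem12:
  fixes n k :: nat
  assumes "1 \<le> k" and "k \<le> n"
  shows "(n \<le> k + 2 \<longrightarrow>
            triple_root_proj n k = zero_locus (coords_without n k) {V_red n k})
       \<and> zariski_closure (coords_without n k) (triple_root_proj n k)
            = zero_locus (coords_without n k) {V_red n k}
       \<and> (3 \<le> n \<longrightarrow> zariski_irreducible (coords_without n k) (triple_root_proj n k))"
proof (intro conjI impI)
  let ?Z = "zero_locus (coords_without n k) {V_red n k}"
  show "triple_root_proj n k = ?Z" if "n \<le> k + 2"
    \<comment> \<open>The exceptional alternative needs \<open>k + 3 \<le> n\<close>.\<close>
    using triple_root_proj_subset[OF assms] zero_locus_V_red_cases[OF assms] that by fastforce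
  show "zariski_closure (coords_without n k) (triple_root_proj n k) = ?Z"
  proof (rule zariski_closure_eq)
    show "algebraic_set (coords_without n k) ?Z"
      unfolding algebraic_set_def using mvars_V_red[OF assms] by blast
    show "triple_root_proj n k \<subseteq> ?Z" by (rule triple_root_proj_subset[OF assms])
    fix z assume z: "z \<in> ?Z - triple_root_proj n k"
    then have "k + 2 \<le> n" "z n = 0" "z (n - 1) = 0"
      using zero_locus_V_red_cases[OF assms, of z] by auto
    with z assms(1) show "\<exists>c. (\<forall>t. t \<noteq> 0 \<longrightarrow> (\<lambda>i. poly (c i) t) \<in> triple_root_proj n k) \<and>
        (\<lambda>i. poly (c i) 0) = z"
      by (intro triple_root_proj_limit_curve) (auto simp: zero_locus_def)
  qed
  show "zariski_irreducible (coords_without n k) (triple_root_proj n k)" if "3 \<le> n"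
    using zariski_irreducible_triple_root_proj assms that by blast
qed

end
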